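(* Let $\{(G_n,r_n),g_n^{n+1}\}_{n\in\mathbb{N}}$ and $\{(H_n,s_n),h_n^{n+1}\}_{n\in\mathbb{N}}$ be g-cell structures. Let $f\colon\bigcup_{i\in\mathbb{N}}G_i\to\bigcup_{i\in\mathbb{N}}H_i$ be a g-cell map. Then there exists a weak g-cell map $\overline{f}\colon G_\infty\to H_\infty$.
   Context: $\mathbb{N}=\{1,2,3,\dots\}$. A cellular graph is a pair $(G,r)$ with $G$ a non-empty topological space and $r\subset G\times G$ a reflexive and symmetric relation. An inverse sequence of cellular graphs $\{(G_n,r_n),g_n^{n+1}\}_{n\in\mathbb{N}}$ consists of cellular graphs $(G_n,r_n)$ and continuous bonding maps $g_n^{n+1}\colon G_{n+1}\to G_n$ with $(g_n^{n+1}(x),g_n^{n+1}(y))\in r_n$ whenever $(x,y)\in r_{n+1}$; $g_n^m\colon G_m\to G_n$ ($n\le m$) denotes the composite, with $g_n^n$ the identity. Its inverse limit is $G_\infty=\{\overline{x}=(x_n)_{n}\in\prod_n G_n : g_i^j(x_j)=x_i \text{ for all } j\ge i\}$ with the subspace topology of the product topology. The natural relation on $G_\infty$ is $r=\{(\overline{x},\overline{y}) : (x_n,y_n)\in r_n \ \forall n\in\mathbb{N}\}$. The inverse sequence is a g-cell structure if $r$ is an equivalence relation. Analogously $H_\infty$ and $s$ are obtained from $\{(H_n,s_n),h_n^{n+1}\}$. Unions $\bigcup_n G_n$, $\bigcup_n H_n$ are disjoint unions. A g-cell map is a set-valued function $f\colon\bigcup_i G_i\to\bigcup_i H_i$ (each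 $f(x)$ is a subset of $\bigcup_i H_i$) such that: (1) $h_i^j(f(x)\cap H_j)\subset f(x)\cap H_i$ for $i\le j$ and all $x$; (2) if $i\le j$, $k\in\mathbb{N}$ and $x\in G_j$ with $f(g_i^j(x))\cap H_k\ne\emptyset$, then $f(x)\cap H_k\neq\emptyset$ and $f(x)\cap H_k\subset f(g_i^j(x))$; (3) if $a\in f(x)\cap H_k$ and $b\in f(y)\cap H_k$, where $x,y\in G_i$ and $(x,y)\in r_i$, then $(a,b)\in s_k$; (4) for each $\overline{x}\in G_\infty$ and $k\in\mathbb{N}$ there exists $i\in\mathbb{N}$ such that $f(x_i)\cap H_k$ is a Hausdorff, compact, nonempty set. A weak g-cell map is a function $\varphi\colon G_\infty\to H_\infty$ such that $(\overline{x},\overline{y})\in r$ implies $(\varphi(\overline{x}),\varphi(\overline{y}))\in s$. *)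

theory Defs
  imports "HOL-Analysis.Analysis"
begin

text \<open>
  The natural numbers start at 1: sequences are functions on \<^typ>\<open>nat\<close> of which only the
  values at indices \<open>n \<ge> 1\<close> are used. The spaces of one sequence share a single point type,
  which is no restriction since a sequence of spaces embeds into the type of its disjoint union.
\<close>

definition cellular_graph :: "'a topology \<Rightarrow> ('a \<times> 'a) set \<Rightarrow> bool" where
  "cellular_graph G r \<longleftrightarrow>
     topspace G \<noteq> {} \<and> r \<subseteq> topspace G \<times> topspace G \<and> refl_on (topspace G) r \<and> sym r"

text \<open>
  \<open>g n\<close> is the bonding map from \<open>G (Suc n)\<close> to \<open>G n\<close>.
\<close>

definition inverse_sequence ::
  "(nat \<Rightarrow> 'a topology) \<Rightarrow> (nat \<Rightarrow> ('a \<times> 'a) set) \<Rightarrow> (nat \<Rightarrow> 'a \<Rightarrow> 'a) \<Rightarrow> bool" where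
  "inverse_sequence G r g \<longleftrightarrow>
     (\<forall>n\<ge>1. cellular_graph (G n) (r n)) \<and>
     (\<forall>n\<ge>1. continuous_map (G (Suc n)) (G n) (g n)) \<and>
     (\<forall>n\<ge>1. \<forall>x y. (x, y) \<in> r (Suc n) \<longrightarrow> (g n x, g n y) \<in> r n)"

text \<open>
  For \<open>n \<le> m\<close>, \<open>bond g n m\<close> is the composite
  \<open>g n \<circ> g (Suc n) \<circ> \<dots> \<circ> g (m - 1)\<close> from \<open>G m\<close> to \<open>G n\<close>; it is the identity for \<open>n = m\<close>.
  It is not used for \<open>m < n\<close>.
\<close>

primrec bond :: "(nat \<Rightarrow> 'a \<Rightarrow> 'a) \<Rightarrow> nat \<Rightarrow> nat \<Rightarrow> 'a \<Rightarrow> 'a" where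
  "bond g n 0 = id"
| "bond g n (Suc m) = (if n \<le> m then bond g n m \<circ> g m else id)"

definition inverse_limit :: "(nat \<Rightarrow> 'a topology) \<Rightarrow> (nat \<Rightarrow> 'a \<Rightarrow> 'a) \<Rightarrow> (nat \<Rightarrow> 'a) topology" where
  "inverse_limit G g =
     subtopology (product_topology G {1..}) {x. \<forall>i\<ge>1. \<forall>j\<ge>i. bond g i j (x j) = x i}"

definition natural_relation ::
  "(nat \<Rightarrow> 'a topology) \<Rightarrow> (nat \<Rightarrow> ('a \<times> 'a) set) \<Rightarrow> (nat \<Rightarrow> 'a \<Rightarrow> 'a) \<Rightarrow> ((nat \<Rightarrow> 'a) \<times> (nat \<Rightarrow> 'a)) set"
  where
  "natural_relation G r g =
     {(x, y). x \<in> topspace (inverse_limit G g) \<and> y \<in> topspace (inverse_limit G g) \<and>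
              (\<forall>n\<ge>1. (x n, y n) \<in> r n)}"

definition g_cell_structure ::
  "(nat \<Rightarrow> 'a topology) \<Rightarrow> (nat \<Rightarrow> ('a \<times> 'a) set) \<Rightarrow> (nat \<Rightarrow> 'a \<Rightarrow> 'a) \<Rightarrow> bool" where
  "g_cell_structure G r g \<longleftrightarrow>
     inverse_sequence G r g \<and> equiv (topspace (inverse_limit G g)) (natural_relation G r g)"

text \<open>
  A point \<open>x\<close> of the \<open>i\<close>-th space is represented in the disjoint union by \<open>(i, x)\<close>.
\<close>

definition disjoint_union :: "(nat \<Rightarrow> 'a topology) \<Rightarrow> (nat \<times> 'a) set" where
  "disjoint_union G = (SIGMA i:{1..}. topspace (G i))"

text \<open>
  The intersection of a subset \<open>A\<close> of the disjoint union with its \<open>k\<close>-th summand, as a set of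
  points of that space.
\<close>

definition level :: "(nat \<times> 'b) set \<Rightarrow> nat \<Rightarrow> 'b set" where
  "level A k = {y. (k, y) \<in> A}"

definition g_cell_map ::
  "(nat \<Rightarrow> 'a topology) \<Rightarrow> (nat \<Rightarrow> ('a \<times> 'a) set) \<Rightarrow> (nat \<Rightarrow> 'a \<Rightarrow> 'a) \<Rightarrow>
   (nat \<Rightarrow> 'b topology) \<Rightarrow> (nat \<Rightarrow> ('b \<times> 'b) set) \<Rightarrow> (nat \<Rightarrow> 'b \<Rightarrow> 'b) \<Rightarrow>
   (nat \<times> 'a \<Rightarrow> (nat \<times> 'b) set) \<Rightarrow> bool" where
  "g_cell_map G r g H s h f \<longleftrightarrow>
     (\<forall>p\<in>disjoint_union G. f p \<subseteq> disjoint_union H) \<and>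
     (\<forall>p\<in>disjoint_union G. \<forall>i\<ge>1. \<forall>j\<ge>i.
        bond h i j ` level (f p) j \<subseteq> level (f p) i) \<and>
     (\<forall>i\<ge>1. \<forall>j\<ge>i. \<forall>k\<ge>1. \<forall>x\<in>topspace (G j).
        level (f (i, bond g i j x)) k \<noteq> {} \<longrightarrow>
        level (f (j, x)) k \<noteq> {} \<and> level (f (j, x)) k \<subseteq> level (f (i, bond g i j x)) k) \<and>
     (\<forall>i\<ge>1. \<forall>k\<ge>1. \<forall>x\<in>topspace (G i). \<forall>y\<in>topspace (G i). (x, y) \<in> r i \<longrightarrow>
        (\<forall>a\<in>level (f (i, x)) k. \<forall>b\<in>level (f (i, y)) k. (a, b) \<in> s k)) \<and>
     (\<forall>x\<in>topspace (inverse_limit G g). \<forall>k\<ge>1. \<exists>i\<ge>1.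
        Hausdorff_space (subtopology (H k) (level (f (i, x i)) k)) \<and>
        compactin (H k) (level (f (i, x i)) k) \<and>
        level (f (i, x i)) k \<noteq> {})"

definition weak_g_cell_map ::
  "(nat \<Rightarrow> 'a topology) \<Rightarrow> (nat \<Rightarrow> ('a \<times> 'a) set) \<Rightarrow> (nat \<Rightarrow> 'a \<Rightarrow> 'a) \<Rightarrow>
   (nat \<Rightarrow> 'b topology) \<Rightarrow> (nat \<Rightarrow> ('b \<times> 'b) set) \<Rightarrow> (nat \<Rightarrow> 'b \<Rightarrow> 'b) \<Rightarrow>
   ((nat \<Rightarrow> 'a) \<Rightarrow> (nat \<Rightarrow> 'b)) \<Rightarrow> bool" where
  "weak_g_cell_map G r g H s h \<phi> \<longleftrightarrow>
     \<phi> \<in> topspace (inverse_limit G g) \<rightarrow> topspace (inverse_limit H h) \<and>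
     (\<forall>x y. (x, y) \<in> natural_relation G r g \<longrightarrow> (\<phi> x, \<phi> y) \<in> natural_relation H s h)"

end

theory Submission
  imports Defs
begin

text \<open>
  Fix \<open>x \<in> G\<^sub>\<infinity>\<close> and write \<open>f(x\<^sub>i)\<^sub>k\<close> for the part of \<open>f(x\<^sub>i)\<close> in \<open>H\<^sub>k\<close>. Condition (4) of a g-cell
  map provides for every \<open>k\<close> an index \<open>n k\<close> such that \<open>f(x\<^bsub>n k\<^esub>)\<^sub>k\<close> is compact, Hausdorff and
  non-empty. If \<open>k \<le> l\<close> and \<open>n k \<le> n l\<close>, then the bonding map from \<open>H\<^sub>l\<close> to \<open>H\<^sub>k\<close> carries
  \<open>f(x\<^bsub>n l\<^esub>)\<^sub>l\<close> into \<open>f(x\<^bsub>n l\<^esub>)\<^sub>k\<close> by (1), and this set lies in \<open>f(x\<^bsub>n k\<^esub>)\<^sub>k\<close> by (2). Nothing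
  relates \<open>n k\<close> and \<open>n l\<close> in general, but a sequence of natural numbers has a non-decreasing
  subsequence (\<open>nat_seq_mono_subseq\<close>). Along it the sets form an inverse sequence of non-empty
  compact Hausdorff spaces, so they contain a thread (\<open>compact_Hausdorff_thread\<close>), which
  a cofinality argument (\<open>inverse_limit_point_of_cofinal_thread\<close>) extends to a point \<open>y\<close> of
  \<open>H\<^sub>\<infinity>\<close> with every \<open>y\<^sub>k\<close> in some \<open>f(x\<^sub>i)\<^sub>k\<close> (\<open>g_cell_map_thread\<close>).

  It remains to respect the relations. For related \<open>x\<close> and \<open>x'\<close> the chosen points need not be
  related coordinatewise: the indices \<open>i\<close> occurring for \<open>x\<close> and for \<open>x'\<close> may differ, while (3)
  compares values at one common \<open>i\<close> only. As \<open>r\<close> is an equivalence relation, the point \<open>y\<close> can be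
  chosen once for each \<open>r\<close>-class instead, from a representative of the class; related points then
  have equal images, and \<open>s\<close> is reflexive. Once \<open>H\<^sub>\<infinity>\<close> has a point, a constant map would be a weak
  g-cell map as well; choosing by classes gives one whose coordinates are values of \<open>f\<close> along a
  point related to the argument.
\<close>

section \<open>Sequences of natural numbers\<close>

lemma nat_seq_mono_subseq:
  fixes n :: "nat \<Rightarrow> nat"
  obtains \<sigma> :: "nat \<Rightarrow> nat" where "strict_mono \<sigma>" "mono (n \<circ> \<sigma>)"
proof -
  obtain \<tau> :: "nat \<Rightarrow> nat" where \<tau>: "strict_mono \<tau>" "monoseq (\<lambda>j. n (\<tau> j))"
    using seq_monosub by blast
  show thesis
  proof (cases "incseq (\<lambda>j. n (\<tau> j))")
    case True
    then show ?thesis using that[of \<tau>] \<tau>(1) by (simp add: o_def)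
  next
    case False
    then have dec: "decseq (\<lambda>j. n (\<tau> j))"
      using \<tau>(2) by (simp add: monoseq_iff)
    \<comment> \<open>A non-increasing sequence of natural numbers is constant once it attains its minimum.\<close>
    obtain N where N: "\<And>j. n (\<tau> N) \<le> n (\<tau> j)"
      using ex_has_least_nat[of "\<lambda>_. True" 0 "\<lambda>j. n (\<tau> j)"] by auto
    have const: "n (\<tau> (N + j)) = n (\<tau> N)" for j
      using N[of "N + j"] decseqD[OF dec, of N "N + j"] by simp
    show ?thesis
    proof (rule that[of "\<lambda>j. \<tau> (N + j)"])
      show "strict_mono (\<lambda>j. \<tau> (N + j))"
        using \<tau>(1) by (simp add: strict_mono_def)
      show "mono (n \<circ> (\<lambda>j. \<tau> (N + j)))"
        by (simp add: mono_def const)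
    qed
  qed
qed

section \<open>Composites of bonding maps\<close>

lemma bond_refl [simp]: "bond g n n = id"
  by (cases n) simp_all

lemma bond_trans:
  assumes "i \<le> j" "j \<le> k"
  shows "bond g i j (bond g j k x) = bond g i k x"
  using assms(2)
proof (induction k arbitrary: x rule: dec_induct)
  case base
  then show ?case by simp
next
  case (step k)
  then show ?case using assms(1) by simp
qed

lemma continuous_map_bond:
  assumes "\<And>n. n \<ge> i \<Longrightarrow> continuous_map (H (Suc n)) (H n) (h n)" and "i \<le> j"
  shows "continuous_map (H j) (H i) (bond h i j)"
  using assms(2)
proof (induction j rule: dec_induct)
  case base
  then show ?case by simp
next
  case (step j)
  have "bond h i (Suc j) = bond h i j \<circ> h j" using step.hyps by (simp add: fun_eq_iff)
  then show ?case
    using continuous_map_compose[OF assms(1)[OF step.hyps(1)] step.IH] by (simp only:)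
qed

section \<open>Threads in inverse sequences of compact Hausdorff spaces\<close>

text \<open>
  The points of the product that are compatible up to stage \<open>n\<close> form a non-empty set, found by
  pushing a point of the \<open>n\<close>-th space down, and this set is closed because the spaces are
  Hausdorff. These sets decrease with \<open>n\<close>, and the product is compact by Tychonoff's theorem.
\<close>

lemma compact_Hausdorff_thread:
  fixes X :: "nat \<Rightarrow> 'a topology"
  assumes comp: "\<And>n. compact_space (X n)" and haus: "\<And>n. Hausdorff_space (X n)"
    and ne: "\<And>n. topspace (X n) \<noteq> {}"
    and cont: "\<And>n. continuous_map (X (Suc n)) (X n) (q n)"
  obtains z where "\<And>n. z n \<in> topspace (X n)" "\<And>n. q n (z (Suc n)) = z n"
proof -
  define P where "P = product_topology X UNIV"
  define E where "E n = {y \<in> topspace P. \<forall>m<n. q m (y (Suc m)) = y m}" for n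
  have closed_eq: "closedin P {y \<in> topspace P. q m (y (Suc m)) = y m}" for m
  proof (rule closedin_continuous_maps_eq[OF haus[of m]])
    have "continuous_map P (X (Suc m)) (\<lambda>y. y (Suc m))"
      unfolding P_def by (rule continuous_map_product_projection) simp
    then show "continuous_map P (X m) (\<lambda>y. q m (y (Suc m)))"
      using continuous_map_compose[OF _ cont[of m]] by (simp add: o_def)
    show "continuous_map P (X m) (\<lambda>y. y m)"
      unfolding P_def by (rule continuous_map_product_projection) simp
  qed
  have E_Suc: "E (Suc n) = E n \<inter> {y \<in> topspace P. q n (y (Suc n)) = y n}" for n
    by (auto simp: E_def less_Suc_eq)
  have E_closed: "closedin P (E n)" for n
  proof (induction n)
    case 0
    then show ?case by (simp add: E_def)
  next
    case (Suc n)
    then show ?case unfolding E_Suc using closed_eq by (intro closedin_Int)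
  qed
  have E_ne: "E n \<noteq> {}" for n
  proof -
    obtain p where p: "p \<in> topspace (X n)" using ne[of n] by blast
    define y where "y m = (if m \<le> n then bond q m n p else (SOME a. a \<in> topspace (X m)))" for m
    have "y m \<in> topspace (X m)" for m
    proof (cases "m \<le> n")
      case True
      then have "continuous_map (X n) (X m) (bond q m n)"
        using continuous_map_bond cont by blast
      then show ?thesis
        using True p by (auto simp: y_def continuous_map_def)
    next
      case False
      then show ?thesis using ne[of m] by (simp add: y_def some_in_eq)
    qed
    moreover have "q m (y (Suc m)) = y m" if "m < n" for m
      using that bond_trans[of m "Suc m" n q p] by (simp add: y_def)
    ultimately have "y \<in> E n" by (simp add: E_def P_def PiE_UNIV_domain)
    then show ?thesis by blast
  qed
  have "compact_space P"
    unfolding P_def using comp by (simp add: compact_space_product_topology)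
  moreover have "decseq E"
    by (auto simp: decseq_def E_def)
  ultimately have "(\<Inter>n. E n) \<noteq> {}"
    by (intro compact_space_imp_nest[of P] E_closed E_ne)
  then obtain z where z: "\<And>n. z \<in> E n" by blast
  show thesis
  proof (rule that[of z])
    show "z n \<in> topspace (X n)" for n
      using z[of 0] by (auto simp: E_def P_def PiE_UNIV_domain)
    show "q n (z (Suc n)) = z n" for n
      using z[of "Suc n"] by (simp add: E_def)
  qed
qed

lemma bond_of_cofinal_thread:
  assumes K: "strict_mono K" and z: "\<And>j. bond h (K j) (K (Suc j)) (z (Suc j)) = z j"
    and "i \<le> j"
  shows "bond h (K i) (K j) (z j) = z i"
  using assms(3)
proof (induction j rule: dec_induct)
  case base
  then show ?case by simp
next
  case (step j)
  have "K i \<le> K j" "K j \<le> K (Suc j)"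
    using K step.hyps by (simp_all add: strict_mono_less_eq)
  then have "bond h (K i) (K (Suc j)) (z (Suc j)) =
      bond h (K i) (K j) (bond h (K j) (K (Suc j)) (z (Suc j)))"
    by (simp only: bond_trans)
  with z step.IH show ?case by simp
qed

text \<open>
  Since \<open>k \<le> K k\<close> for a strictly increasing \<open>K\<close>, the \<open>k\<close>-th coordinate can be read off from the
  \<open>k\<close>-th term of the thread. The restriction to \<open>{1..}\<close> reflects that points of a
  product are \<open>undefined\<close> outside the index set.
\<close>

lemma inverse_limit_point_of_cofinal_thread:
  assumes K: "strict_mono K" and z: "\<And>j. bond h (K j) (K (Suc j)) (z (Suc j)) = z j"
    and top: "\<And>k. k \<ge> 1 \<Longrightarrow> bond h k (K k) (z k) \<in> topspace (H k)"
  shows "restrict (\<lambda>k. bond h k (K k) (z k)) {1..} \<in> topspace (inverse_limit H h)"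
proof -
  have "bond h i j (bond h j (K j) (z j)) = bond h i (K i) (z i)" if "i \<le> j" for i j
  proof -
    have le: "i \<le> K i" "j \<le> K j" "K i \<le> K j"
      using K that by (simp_all add: strict_mono_imp_increasing strict_mono_less_eq)
    have "bond h i j (bond h j (K j) (z j)) = bond h i (K i) (bond h (K i) (K j) (z j))"
      using le that by (simp add: bond_trans)
    also have "bond h (K i) (K j) (z j) = z i"
      using bond_of_cofinal_thread[where h = h, OF K z that] .
    finally show ?thesis .
  qed
  then show ?thesis
    using top by (auto simp: inverse_limit_def)
qed

section \<open>The map induced by a g-cell map\<close>

text \<open>
  The non-decreasing subsequence makes the compact Hausdorff pieces given by condition (4) into
  an inverse sequence; for the sequence of all levels, the bonding maps need not carry one
  piece into the preceding one.
\<close>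

lemma g_cell_map_thread:
  assumes seq: "inverse_sequence H s h" and fmap: "g_cell_map G r g H s h f"
    and x: "x \<in> topspace (inverse_limit G g)"
  obtains y where "y \<in> topspace (inverse_limit H h)"
    "\<And>k. k \<ge> 1 \<Longrightarrow> \<exists>i\<ge>1. y k \<in> level (f (i, x i)) k"
proof -
  have f_in: "f p \<subseteq> disjoint_union H" if "p \<in> disjoint_union G" for p
    using fmap[unfolded g_cell_map_def, THEN conjunct1] that by (rule bspec)
  note f_bond = fmap[unfolded g_cell_map_def, THEN conjunct2, THEN conjunct1]
  note f_mono = fmap[unfolded g_cell_map_def, THEN conjunct2, THEN conjunct2, THEN conjunct1]
  note f_compact = fmap[unfolded g_cell_map_def, THEN conjunct2, THEN conjunct2, THEN conjunct2,
      THEN conjunct2]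
  have xG: "x i \<in> topspace (G i)" if "i \<ge> 1" for i
    using x that by (auto simp: inverse_limit_def)
  have xbond: "bond g i j (x j) = x i" if "i \<ge> 1" "i \<le> j" for i j
    using x that by (auto simp: inverse_limit_def)
  have level_sub: "level (f (i, x i)) k \<subseteq> topspace (H k)" if "i \<ge> 1" for i k
    using f_in[of "(i, x i)"] xG[OF that] that by (auto simp: disjoint_union_def level_def)
  have level_bond: "bond h k l a \<in> level (f (i, x i)) k"
    if "i \<ge> 1" "k \<ge> 1" "k \<le> l" "a \<in> level (f (i, x i)) l" for i k l a
  proof -
    have "(i, x i) \<in> disjoint_union G" using xG that by (simp add: disjoint_union_def)
    then have "bond h k l ` level (f (i, x i)) l \<subseteq> level (f (i, x i)) k"
      using f_bond that(2,3) by blast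
    then show ?thesis using that(4) by blast
  qed
  have level_mono: "level (f (j, x j)) k \<subseteq> level (f (i, x i)) k"
    if "i \<ge> 1" "i \<le> j" "k \<ge> 1" "level (f (i, x i)) k \<noteq> {}" for i j k
  proof -
    have "level (f (j, x j)) k \<subseteq> level (f (i, bond g i j (x j))) k"
      using f_mono[rule_format, of i j k "x j"] that xG[of j] xbond[of i j] by simp
    then show ?thesis using xbond[of i j] that by simp
  qed
  have "\<exists>i. i \<ge> 1 \<and> Hausdorff_space (subtopology (H k) (level (f (i, x i)) k)) \<and>
        compactin (H k) (level (f (i, x i)) k) \<and> level (f (i, x i)) k \<noteq> {}" if "k \<ge> 1" for k
    using f_compact[rule_format, OF x that] .
  then obtain n where n: "\<And>k. k \<ge> 1 \<Longrightarrow> n k \<ge> 1 \<and>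
        Hausdorff_space (subtopology (H k) (level (f (n k, x (n k))) k)) \<and>
        compactin (H k) (level (f (n k, x (n k))) k) \<and> level (f (n k, x (n k))) k \<noteq> {}"
    by metis
  \<comment> \<open>The shift by one keeps the subsequence within the levels \<open>k \<ge> 1\<close>.\<close>
  obtain \<sigma> :: "nat \<Rightarrow> nat" where \<sigma>: "strict_mono \<sigma>" "mono ((\<lambda>k. n (Suc k)) \<circ> \<sigma>)"
    by (rule nat_seq_mono_subseq[of "\<lambda>k. n (Suc k)"])
  define K where "K j = Suc (\<sigma> j)" for j
  have K: "strict_mono K" using \<sigma>(1) by (simp add: K_def strict_mono_def)
  have K1: "K j \<ge> 1" for j by (simp add: K_def)
  have nK: "n (K i) \<le> n (K j)" if "i \<le> j" for i j
    using \<sigma>(2) that by (simp add: K_def mono_def)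
  define C where "C j = level (f (n (K j), x (n (K j)))) (K j)" for j
  have C: "Hausdorff_space (subtopology (H (K j)) (C j))" "compactin (H (K j)) (C j)"
    "C j \<noteq> {}" for j
    using n[OF K1[of j]] by (simp_all add: C_def)
  have topC: "topspace (subtopology (H (K j)) (C j)) = C j" for j
    using compactin_subset_topspace[OF C(2)[of j]] by (simp add: Int_absorb1)
  have KSuc: "K j \<le> K (Suc j)" for j using K by (simp add: strict_mono_less_eq)
  have bondC: "bond h (K j) (K (Suc j)) a \<in> C j" if "a \<in> C (Suc j)" for j a
  proof -
    have "bond h (K j) (K (Suc j)) a \<in> level (f (n (K (Suc j)), x (n (K (Suc j))))) (K j)"
      using level_bond[OF _ K1 KSuc] n[OF K1] that unfolding C_def by simp
    moreover have "\<dots> \<subseteq> C j"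
      using level_mono[of "n (K j)" "n (K (Suc j))" "K j"] n[OF K1[of j]] K1 nK
      unfolding C_def by simp
    ultimately show ?thesis by blast
  qed
  obtain z where z: "\<And>j. z j \<in> topspace (subtopology (H (K j)) (C j))"
    "\<And>j. bond h (K j) (K (Suc j)) (z (Suc j)) = z j"
  proof (rule compact_Hausdorff_thread[of "\<lambda>j. subtopology (H (K j)) (C j)"
        "\<lambda>j. bond h (K j) (K (Suc j))"])
    show "compact_space (subtopology (H (K j)) (C j))" for j
      using C(2) by (simp add: compact_space_subtopology)
    show "topspace (subtopology (H (K j)) (C j)) \<noteq> {}" for j
      unfolding topC using C(3) .
    show "continuous_map (subtopology (H (K (Suc j))) (C (Suc j))) (subtopology (H (K j)) (C j))
            (bond h (K j) (K (Suc j)))" for j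
    proof -
      have "continuous_map (H (K (Suc j))) (H (K j)) (bond h (K j) (K (Suc j)))"
        using seq K1[of j] KSuc by (intro continuous_map_bond) (auto simp: inverse_sequence_def)
      then show ?thesis
        using bondC topC
        by (auto simp: continuous_map_in_subtopology continuous_map_from_subtopology)
    qed
  qed (use C(1) in auto)
  have coord: "bond h k (K k) (z k) \<in> level (f (n (K k), x (n (K k)))) k" if "k \<ge> 1" for k
    using level_bond[OF _ that strict_mono_imp_increasing[OF K]] n[OF K1[of k]] z(1)[of k]
    unfolding topC C_def by simp
  show thesis
  proof (rule that)
    show "restrict (\<lambda>k. bond h k (K k) (z k)) {1..} \<in> topspace (inverse_limit H h)"
    proof (rule inverse_limit_point_of_cofinal_thread[OF K z(2)])
      show "bond h k (K k) (z k) \<in> topspace (H k)" if "k \<ge> 1" for k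
        using coord[OF that] level_sub n[OF K1[of k]] by blast
    qed
    show "\<exists>i\<ge>1. restrict (\<lambda>k. bond h k (K k) (z k)) {1..} k \<in> level (f (i, x i)) k"
      if "k \<ge> 1" for k
      using coord[OF that] n[OF K1[of k]] that by auto
  qed
qed

theorem proposition3p4:
  fixes G :: "nat \<Rightarrow> 'a topology" and r :: "nat \<Rightarrow> ('a \<times> 'a) set" and g :: "nat \<Rightarrow> 'a \<Rightarrow> 'a"
    and H :: "nat \<Rightarrow> 'b topology" and s :: "nat \<Rightarrow> ('b \<times> 'b) set" and h :: "nat \<Rightarrow> 'b \<Rightarrow> 'b"
    and f :: "nat \<times> 'a \<Rightarrow> (nat \<times> 'b) set"
  assumes "g_cell_structure G r g" and "g_cell_structure H s h"
    and "g_cell_map G r g H s h f"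
  shows "\<exists>f_bar. weak_g_cell_map G r g H s h f_bar"
proof -
  let ?X = "topspace (inverse_limit G g)" and ?Y = "topspace (inverse_limit H h)"
  let ?r = "natural_relation G r g" and ?s = "natural_relation H s h"
  have r: "equiv ?X ?r" and s: "equiv ?Y ?s" and seq: "inverse_sequence H s h"
    using assms(1,2) by (simp_all add: g_cell_structure_def)
  have "\<exists>y. y \<in> ?Y \<and> (\<forall>k\<ge>1. \<exists>i\<ge>1. y k \<in> level (f (i, x i)) k)" if "x \<in> ?X" for x
    using g_cell_map_thread[OF seq assms(3) that] by metis
  then obtain \<phi> where \<phi>: "\<And>x. x \<in> ?X \<Longrightarrow> \<phi> x \<in> ?Y"
    "\<And>x k. x \<in> ?X \<Longrightarrow> k \<ge> 1 \<Longrightarrow> \<exists>i\<ge>1. \<phi> x k \<in> level (f (i, x i)) k"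
    by metis
  define rep where "rep x = (SOME x'. x' \<in> ?r `` {x})" for x
  have rep: "rep x \<in> ?X" if "x \<in> ?X" for x
  proof -
    have "x \<in> ?r `` {x}" using equiv_class_self[OF r that] .
    then have "rep x \<in> ?r `` {x}" unfolding rep_def by (rule someI[of "\<lambda>x'. x' \<in> ?r `` {x}"])
    then show ?thesis by (auto simp: natural_relation_def)
  qed
  have "weak_g_cell_map G r g H s h (\<phi> \<circ> rep)"
    unfolding weak_g_cell_map_def
  proof (intro conjI allI impI)
    show "\<phi> \<circ> rep \<in> ?X \<rightarrow> ?Y" using \<phi>(1) rep by auto
  next
    fix x x' assume xx': "(x, x') \<in> ?r"
    then have "x \<in> ?X" by (simp add: natural_relation_def)
    moreover have "rep x = rep x'"
      unfolding rep_def using equiv_class_eq[OF r xx'] by simp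
    moreover have "(\<phi> (rep x), \<phi> (rep x)) \<in> ?s" if "x \<in> ?X"
      using equiv_class_self[OF s \<phi>(1)[OF rep[OF that]]] by simp
    ultimately show "((\<phi> \<circ> rep) x, (\<phi> \<circ> rep) x') \<in> ?s"
      by simp
  qed
  then show ?thesis by blast
qed

end
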